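(* Let $\Gamma=\langle n_1,n_2,\dots,n_m\rangle$ be a telescopic numerical semigroup with $n_1<\cdots<n_m$. Then for every $z\in\mathbb{N}$ we have $$\#\operatorname{Ap}(\Gamma,z)\geq n_1\left\lceil\frac{z}{n_m}\right\rceil;$$ hence $\mathrm E(\Gamma,2)=n_1$.
   Context: $\mathbb N$ denotes the non-negative integers. A numerical semigroup is a set $\langle n_1,\dots,n_m\rangle:=n_1\mathbb N+\cdots+n_m\mathbb N$ with $n_i$ positive integers and $\gcd(n_1,\dots,n_m)=1$. A set $A$ of positive integers is the minimal generating set of $\Gamma$ if $\Gamma=\langle A\rangle\ne\langle A\setminus\{n\}\rangle$ for every $n\in A$; its elements are the minimal generators. For $x\in\mathbb Z$, the Apéry set is $\operatorname{Ap}(\Gamma,x)=\{a\in\Gamma\mid a-x\notin\Gamma\}$. Gluing: given numerical semigroups $\Gamma_1,\Gamma_2$, $a_1\in\Gamma_2$ and $a_2\in\Gamma_1$ with $\gcd(a_1,a_2)=1$, $a_1$ not a minimal generator of $\Gamma_2$ and $a_2$ not a minimal generator of $\Gamma_1$, the numerical semigroup $a_1\Gamma_1+a_2\Gamma_2$ is called a gluing of $\Gamma_1$ and $\Gamma_2$. Telescopic (recursive definition): $\Gamma$ is telescopic if either $\Gamma=\mathbb N$, or $\Gamma=a_1\Gamma_1+a_2\mathbb N$ is a gluing of $\Gamma_1$ and $\mathbb N$ with $\Gamma_1$ telescopic and $a_2>a_1n$ for each minimal generator $n$ of $\Gamma_1$. Second Feng-Rao number: for $b\in\Gamma$ let $\mathrm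 D(b)=\{c\in\Gamma\mid b-c\in\Gamma\}$, and let $\delta^2_{FR}(a)=\min\{\#(\mathrm D(b_1)\cup \mathrm D(b_2))\mid b_1,b_2\in\Gamma,\ a\le b_1<b_2\}$. With $c$ the conductor of $\Gamma$ (least integer $c \ge 0$ such that all integers $\ge c$ lie in $\Gamma$) and $g=\#(\mathbb N\setminus\Gamma)$ the genus, $\mathrm E(\Gamma,2)$ is the constant such that $\delta^2_{FR}(a)=a+1-2g+\mathrm E(\Gamma,2)$ for all non-negative integers $a\ge 2c-1$. It is known (and may be taken as the definition) that $\mathrm E(\Gamma,2)=\min\{\#\operatorname{Ap}(\Gamma,x)\mid x\in\mathbb N\setminus\{0\}\}$. *)

theory Defs
  imports Complex_Main
begin

definition gen_by :: "nat set \<Rightarrow> nat set" where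
  "gen_by A = {\<Sum>a\<in>A. k a * a | k :: nat \<Rightarrow> nat. True}"

definition numerical_semigroup :: "nat set \<Rightarrow> bool" where
  "numerical_semigroup \<Gamma> \<longleftrightarrow>
     (\<exists>A. finite A \<and> (\<forall>n\<in>A. n > 0) \<and> Gcd A = 1 \<and> \<Gamma> = gen_by A)"

definition minimal_generating_set :: "nat set \<Rightarrow> nat set \<Rightarrow> bool" where
  "minimal_generating_set \<Gamma> A \<longleftrightarrow>
     finite A \<and> (\<forall>n\<in>A. n > 0) \<and> \<Gamma> = gen_by A \<and> (\<forall>n\<in>A. gen_by A \<noteq> gen_by (A - {n}))"

definition minimal_generator :: "nat set \<Rightarrow> nat \<Rightarrow> bool" where
  "minimal_generator \<Gamma> n \<longleftrightarrow> (\<exists>A. minimal_generating_set \<Gamma> A \<and> n \<in> A)"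

text \<open>Differences of elements are taken in the integers, so that they are not truncated.\<close>

definition Ap :: "nat set \<Rightarrow> int \<Rightarrow> nat set" where
  "Ap \<Gamma> x = {a \<in> \<Gamma>. int a - x \<notin> int ` \<Gamma>}"

definition is_gluing :: "nat set \<Rightarrow> nat \<Rightarrow> nat set \<Rightarrow> nat \<Rightarrow> nat set \<Rightarrow> bool" where
  "is_gluing \<Gamma> a1 \<Gamma>1 a2 \<Gamma>2 \<longleftrightarrow>
     numerical_semigroup \<Gamma>1 \<and> numerical_semigroup \<Gamma>2 \<and>
     a1 \<in> \<Gamma>2 \<and> a2 \<in> \<Gamma>1 \<and> coprime a1 a2 \<and>
     \<not> minimal_generator \<Gamma>2 a1 \<and> \<not> minimal_generator \<Gamma>1 a2 \<and>
     \<Gamma> = {a1 * x + a2 * y | x y. x \<in> \<Gamma>1 \<and> y \<in> \<Gamma>2}"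

inductive telescopic :: "nat set \<Rightarrow> bool" where
  telescopic_UNIV: "telescopic UNIV"
| telescopic_gluing:
    "telescopic \<Gamma>1 \<Longrightarrow> is_gluing \<Gamma> a1 \<Gamma>1 a2 UNIV \<Longrightarrow>
     (\<forall>n. minimal_generator \<Gamma>1 n \<longrightarrow> a2 > a1 * n) \<Longrightarrow> telescopic \<Gamma>"

definition conductor :: "nat set \<Rightarrow> nat" where
  "conductor \<Gamma> = (LEAST c. \<forall>x\<ge>c. x \<in> \<Gamma>)"

definition genus :: "nat set \<Rightarrow> nat" where
  "genus \<Gamma> = card (- \<Gamma>)"

definition divisors_in :: "nat set \<Rightarrow> nat \<Rightarrow> nat set" where
  "divisors_in \<Gamma> b = {c \<in> \<Gamma>. int b - int c \<in> int ` \<Gamma>}"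

text \<open>The infimum of a nonempty set of natural numbers is its minimum.\<close>

definition feng_rao2 :: "nat set \<Rightarrow> nat \<Rightarrow> nat" where
  "feng_rao2 \<Gamma> a =
     Inf {card (divisors_in \<Gamma> b1 \<union> divisors_in \<Gamma> b2) | b1 b2.
            b1 \<in> \<Gamma> \<and> b2 \<in> \<Gamma> \<and> a \<le> b1 \<and> b1 < b2}"

definition E2 :: "nat set \<Rightarrow> int" where
  "E2 \<Gamma> = (THE e. \<forall>a::nat. int a \<ge> 2 * int (conductor \<Gamma>) - 1 \<longrightarrow>
     int (feng_rao2 \<Gamma> a) = int a + 1 - 2 * int (genus \<Gamma>) + e)"

end

theory Submission
  imports Defs
begin

text \<open>
  For a gluing \<open>\<Gamma> = a1 \<Gamma>1 + a2 \<nat>\<close> and \<open>z = a1 u + a2 i\<close> with \<open>0 \<le> i < a1\<close>, one has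
  \<open>#Ap(\<Gamma>, z) = (a1 - i) #Ap(\<Gamma>1, u) + i #Ap(\<Gamma>1, u + a2)\<close>, where \<open>u\<close> may be negative. Since
  \<open>a2\<close> exceeds \<open>a1\<close> times every minimal generator of \<open>\<Gamma>1\<close>, the lower bound passes from \<open>\<Gamma>1\<close>
  to \<open>\<Gamma>\<close>. For \<open>E2\<close>, when \<open>2 c - 1 \<le> b1 < b2\<close> the union \<open>D(b1) \<union> D(b2)\<close> has exactly
  \<open>b1 + 1 - 2 g + #Ap(\<Gamma>, b2 - b1)\<close> elements, and the bound at \<open>z \<ge> 1\<close> is attained at \<open>z = n 1\<close>,
  where the elements of the Apery set are pairwise incongruent.
\<close>

section \<open>Generating sets, atoms and minimal generators\<close>

text \<open>An intrinsic form of minimal generators, independent of any choice of generating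
  set.\<close>

definition atom :: "nat set \<Rightarrow> nat \<Rightarrow> bool" where
  "atom \<Gamma> n \<longleftrightarrow> n \<in> \<Gamma> \<and> n > 0 \<and> (\<forall>x\<in>\<Gamma>. \<forall>y\<in>\<Gamma>. n = x + y \<longrightarrow> x = 0 \<or> y = 0)"

lemma gen_by_zero: "0 \<in> gen_by A"
  unfolding gen_by_def by (auto intro!: exI[of _ "\<lambda>_. 0"])

lemma gen_by_add:
  assumes "x \<in> gen_by A" "y \<in> gen_by A"
  shows "x + y \<in> gen_by A"
proof -
  obtain k l where "x = (\<Sum>a\<in>A. k a * a)" "y = (\<Sum>a\<in>A. l a * a)"
    using assms unfolding gen_by_def by auto
  then have "x + y = (\<Sum>a\<in>A. (k a + l a) * a)"
    by (simp add: sum.distrib algebra_simps)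
  then show ?thesis
    unfolding gen_by_def by (intro CollectI exI[of _ "\<lambda>a. k a + l a"]) simp
qed

lemma gen_by_subset:
  assumes "A \<subseteq> B" "finite B"
  shows "gen_by A \<subseteq> gen_by B"
proof
  fix x assume "x \<in> gen_by A"
  then obtain k where x: "x = (\<Sum>a\<in>A. k a * a)"
    unfolding gen_by_def by auto
  have "x = (\<Sum>a\<in>B. (if a \<in> A then k a else 0) * a)"
    unfolding x using assms by (intro sum.mono_neutral_cong_left) auto
  then show "x \<in> gen_by B"
    unfolding gen_by_def by (intro CollectI exI[of _ "\<lambda>a. if a \<in> A then k a else 0"]) simp
qed

lemma generator_in_gen_by:
  assumes "finite A" "a \<in> A"
  shows "a \<in> gen_by A"
proof -
  have "a = (\<Sum>b\<in>A. (if b = a then 1 else 0) * b)"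
    using assms by (subst sum.remove[of A a]) (auto intro!: sum.neutral)
  then show ?thesis
    unfolding gen_by_def by (intro CollectI exI[of _ "\<lambda>b. if b = a then 1 else 0"]) simp
qed

lemma gen_by_split:
  assumes "finite A" "x \<in> gen_by A" "x > 0"
  obtains a y where "a \<in> A" "a > 0" "y \<in> gen_by A" "x = a + y"
proof -
  obtain k where x: "x = (\<Sum>a\<in>A. k a * a)"
    using assms unfolding gen_by_def by auto
  then have "(\<Sum>a\<in>A. k a * a) \<noteq> 0"
    using assms(3) by linarith
  then obtain a where a: "a \<in> A" "k a * a \<noteq> 0"
    using sum.not_neutral_contains_not_neutral by blast
  define l where "l = k(a := k a - 1)"
  have rest: "(\<Sum>b\<in>A - {a}. l b * b) = (\<Sum>b\<in>A - {a}. k b * b)"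
    by (intro sum.cong) (auto simp: l_def)
  have "k a * a = a + l a * a"
    using a by (cases "k a") (auto simp: l_def)
  then have "x = a + (\<Sum>b\<in>A. l b * b)"
    unfolding x using a rest assms(1) by (simp add: sum.remove[of A a])
  moreover have "(\<Sum>b\<in>A. l b * b) \<in> gen_by A"
    unfolding gen_by_def by blast
  ultimately show thesis
    using that a by auto
qed

text \<open>Splitting one generator off an atom leaves remainder 0, so the atom is that
  generator.\<close>

lemma atom_gen_by_in_generators:
  assumes "finite A" "atom (gen_by A) x"
  shows "x \<in> A"
  using assms gen_by_split[of A x] generator_in_gen_by[of A] unfolding atom_def
  by (metis add.right_neutral neq0_conv)

lemma submonoid_mult:
  assumes "0 \<in> \<Gamma>" "\<And>x y. x \<in> \<Gamma> \<Longrightarrow> y \<in> \<Gamma> \<Longrightarrow> x + y \<in> (\<Gamma> :: nat set)" "x \<in> \<Gamma>"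
  shows "k * x \<in> \<Gamma>"
  by (induction k) (use assms in auto)

text \<open>Strong induction: a positive element that is not an atom is a sum of two strictly
  smaller elements.\<close>

lemma gen_by_atoms:
  assumes "finite A"
  shows "gen_by A = gen_by {x. atom (gen_by A) x}" (is "_ = gen_by ?T")
proof
  have sub: "?T \<subseteq> A"
    using atom_gen_by_in_generators[OF assms] by auto
  then show "gen_by ?T \<subseteq> gen_by A"
    using gen_by_subset assms by blast
  have finT: "finite ?T"
    using sub assms finite_subset by blast
  have "x \<in> gen_by A \<longrightarrow> x \<in> gen_by ?T" for x
  proof (induction x rule: less_induct)
    case (less x)
    show ?case
    proof (cases "x = 0 \<or> atom (gen_by A) x")
      case True
      then show ?thesis
        using gen_by_zero generator_in_gen_by[OF finT] by auto
    next
      case False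
      show ?thesis
      proof
        assume "x \<in> gen_by A"
        then obtain y z where "y \<in> gen_by A" "z \<in> gen_by A" "x = y + z" "y \<noteq> 0" "z \<noteq> 0"
          using False unfolding atom_def by auto
        then show "x \<in> gen_by ?T"
          using less.IH[of y] less.IH[of z] gen_by_add by auto
      qed
    qed
  qed
  then show "gen_by A \<subseteq> gen_by ?T"
    by blast
qed

lemma atom_imp_minimal_generator:
  assumes "numerical_semigroup \<Gamma>" "atom \<Gamma> x"
  shows "minimal_generator \<Gamma> x"
proof -
  obtain A where A: "finite A" "\<Gamma> = gen_by A"
    using assms(1) unfolding numerical_semigroup_def by auto
  define T where "T = {x. atom \<Gamma> x}"
  have gen: "\<Gamma> = gen_by T"
    using gen_by_atoms[OF A(1)] A(2) by (simp add: T_def)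
  have finT: "finite T"
    using atom_gen_by_in_generators[OF A(1)] A finite_subset[of T A] by (auto simp: T_def)
  have min: "gen_by T \<noteq> gen_by (T - {n})" if n: "n \<in> T" for n
  proof
    assume eq: "gen_by T = gen_by (T - {n})"
    then have "\<Gamma> = gen_by (T - {n})"
      using gen by blast
    moreover have "atom \<Gamma> n"
      using n by (simp add: T_def)
    ultimately have "atom (gen_by (T - {n})) n"
      by metis
    then show False
      using atom_gen_by_in_generators[of "T - {n}" n] finT by auto
  qed
  have "\<forall>n\<in>T. n > 0"
    by (simp add: T_def atom_def)
  then have "minimal_generating_set \<Gamma> T"
    unfolding minimal_generating_set_def using finT gen min by blast
  then show ?thesis
    using assms(2) unfolding minimal_generator_def T_def by auto
qed

lemma numerical_semigroup_submonoid:
  assumes "numerical_semigroup \<Gamma>"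
  shows "0 \<in> \<Gamma>" "\<And>x y. x \<in> \<Gamma> \<Longrightarrow> y \<in> \<Gamma> \<Longrightarrow> x + y \<in> \<Gamma>"
  using assms gen_by_zero gen_by_add unfolding numerical_semigroup_def by auto

section \<open>Arithmetic and Apery sets of a gluing with the natural numbers\<close>

text \<open>Bezout gives some representation; reducing the coefficient of \<open>b\<close> modulo
  \<open>a\<close> moves the quotient into \<open>u\<close>, which may be negative.\<close>

lemma int_coprime_decomposition:
  fixes a b z :: int
  assumes "coprime a b" "a > 0"
  obtains u j where "0 \<le> j" "j < a" "z = a * u + b * j"
proof -
  obtain p q where "p * a + q * b = 1"
    using bezout_int[of a b] assms by auto
  then have "z = z * (p * a + q * b)"
    by simp
  also have "\<dots> = a * (z * p) + b * (z * q)"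
    by (simp add: algebra_simps)
  also have "\<dots> = a * (z * p) + b * (z * q div a * a + z * q mod a)"
    by simp
  also have "\<dots> = a * (z * p + b * (z * q div a)) + b * (z * q mod a)"
    by (simp only: algebra_simps)
  finally show thesis
    using that assms(2) pos_mod_bound pos_mod_sign by blast
qed

lemma int_coprime_decomposition_unique:
  fixes a b u v i j :: int
  assumes "coprime a b" "0 \<le> i" "i < a" "0 \<le> j" "j < a" "a * u + b * i = a * v + b * j"
  shows "u = v" "i = j"
proof -
  have "b * (i - j) = a * (v - u)"
    using assms(6) by (simp add: algebra_simps)
  then have "a dvd b * (i - j)"
    by simp
  then have "a dvd i - j"
    using assms(1) coprime_dvd_mult_right_iff by blast
  then have "i mod a = j mod a"
    by (simp add: mod_eq_dvd_iff)
  then show "i = j"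
    using assms(2-5) by simp
  then show "u = v"
    using assms by auto
qed

lemma finite_Ap:
  assumes "\<forall>x\<ge>c. x \<in> \<Gamma>"
  shows "finite (Ap \<Gamma> z)"
proof (rule finite_subset)
  show "Ap \<Gamma> z \<subseteq> {..nat (int c + z)}"
  proof
    fix a assume a: "a \<in> Ap \<Gamma> z"
    have "\<not> int c \<le> int a - z"
    proof
      assume "int c \<le> int a - z"
      then have "nat (int a - z) \<in> \<Gamma>" "int a - z = int (nat (int a - z))"
        using assms by (auto simp: le_nat_iff)
      then show False
        using a unfolding Ap_def by blast
    qed
    then show "a \<in> {..nat (int c + z)}"
      by auto
  qed
qed simp

text \<open>Membership is decided by the first coordinate of the normal form: reducing
  \<open>y\<close> modulo \<open>a1\<close> carries a multiple of \<open>a2\<close> into that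
  coordinate, which stays in \<open>\<Gamma>1\<close> since
  \<open>a2 \<in> \<Gamma>1\<close>.\<close>

lemma gluing_UNIV_mem_iff:
  fixes a1 a2 :: nat and x j :: int
  assumes \<Gamma>: "\<Gamma> = {a1 * x + a2 * y | x y. x \<in> \<Gamma>1 \<and> y \<in> UNIV}"
    and add: "\<And>x y. x \<in> \<Gamma>1 \<Longrightarrow> y \<in> \<Gamma>1 \<Longrightarrow> x + y \<in> \<Gamma>1"
    and zero: "0 \<in> \<Gamma>1" and a2: "a2 \<in> \<Gamma>1" and cop: "coprime a1 a2"
    and j: "0 \<le> j" "j < int a1"
  shows "int a1 * x + int a2 * j \<in> int ` \<Gamma> \<longleftrightarrow> x \<in> int ` \<Gamma>1"
proof
  assume "x \<in> int ` \<Gamma>1"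
  then obtain x' where x': "x' \<in> \<Gamma>1" "x = int x'"
    by auto
  then have "int a1 * x + int a2 * j = int (a1 * x' + a2 * nat j)" "a1 * x' + a2 * nat j \<in> \<Gamma>"
    using j \<Gamma> by auto
  then show "int a1 * x + int a2 * j \<in> int ` \<Gamma>"
    by blast
next
  assume "int a1 * x + int a2 * j \<in> int ` \<Gamma>"
  then obtain x' y where x': "x' \<in> \<Gamma>1" and eq: "int a1 * x + int a2 * j = int (a1 * x' + a2 * y)"
    unfolding \<Gamma> by blast
  have "int y = int (y mod a1) + int a1 * int (y div a1)"
    by (metis add.commute mult_div_mod_eq of_nat_add of_nat_mult)
  then have "int a1 * x + int a2 * j
      = int a1 * (int x' + int a2 * int (y div a1)) + int a2 * int (y mod a1)"
    using eq by (simp add: algebra_simps)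
  then have "x = int x' + int a2 * int (y div a1)"
    using int_coprime_decomposition_unique(1)[of "int a1" "int a2" j "int (y mod a1)" x] cop j
    by simp
  moreover have "x' + (y div a1) * a2 \<in> \<Gamma>1"
    using add x' submonoid_mult[OF zero add a2] by blast
  ultimately show "x \<in> int ` \<Gamma>1"
    by (intro image_eqI[of _ _ "x' + (y div a1) * a2"]) (auto simp: algebra_simps)
qed

text \<open>Every integer is uniquely \<open>a1 * x + a2 * j\<close> with \<open>0 \<le> j < a1\<close>; subtracting
  \<open>a1 * u + a2 * i\<close> from it borrows \<open>a2\<close> from \<open>x\<close> exactly when \<open>j < i\<close>.\<close>

lemma card_Ap_gluing_UNIV:
  fixes a1 a2 i :: nat and u :: int
  assumes \<Gamma>: "\<Gamma> = {a1 * x + a2 * y | x y. x \<in> \<Gamma>1 \<and> y \<in> UNIV}"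
    and add: "\<And>x y. x \<in> \<Gamma>1 \<Longrightarrow> y \<in> \<Gamma>1 \<Longrightarrow> x + y \<in> \<Gamma>1"
    and zero: "0 \<in> \<Gamma>1" and a2: "a2 \<in> \<Gamma>1" and cop: "coprime a1 a2"
    and fin: "\<And>v. finite (Ap \<Gamma>1 v)" and i: "i < a1"
  shows "card (Ap \<Gamma> (int a1 * u + int a2 * int i))
    = (a1 - i) * card (Ap \<Gamma>1 u) + i * card (Ap \<Gamma>1 (u + int a2))"
proof -
  note mem = gluing_UNIV_mem_iff[OF \<Gamma> add zero a2 cop]
  \<comment> \<open>\<open>B j\<close> is the fibre of the Apery set over the residue
    \<open>j\<close>.\<close>
  define B where "B j = (if j < i then Ap \<Gamma>1 (u + int a2) else Ap \<Gamma>1 u)" for j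
  define f where "f = (\<lambda>(j, x). a1 * x + a2 * j)"
  have mem_Ap: "a1 * x + a2 * j \<in> Ap \<Gamma> (int a1 * u + int a2 * int i) \<longleftrightarrow> x \<in> B j"
    if j: "j < a1" for x j
  proof -
    have 1: "a1 * x + a2 * j \<in> \<Gamma> \<longleftrightarrow> x \<in> \<Gamma>1"
      using mem[of "int j" "int x"] j
      by (metis (no_types, lifting) inj_image_mem_iff inj_of_nat of_nat_0_le_iff of_nat_add
          of_nat_less_iff of_nat_mult)
    show ?thesis
    proof (cases "j < i")
      case True
      \<comment> \<open>Here \<open>j - i\<close> is negative; adding \<open>a1\<close> brings it
        back into the range of the normal form, at the cost of \<open>a2\<close> in the first
        coordinate.\<close>
      have "int (a1 * x + a2 * j) - (int a1 * u + int a2 * int i)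
          = int a1 * (int x - (u + int a2)) + int a2 * (int j - int i + int a1)"
        by (simp add: algebra_simps)
      then show ?thesis
        using mem[of "int j - int i + int a1"] True 1 i j unfolding Ap_def B_def by auto
    next
      case False
      have "int (a1 * x + a2 * j) - (int a1 * u + int a2 * int i)
          = int a1 * (int x - u) + int a2 * (int j - int i)"
        by (simp add: algebra_simps)
      then show ?thesis
        using mem[of "int j - int i"] False 1 i j unfolding Ap_def B_def by auto
    qed
  qed
  have "bij_betw f (SIGMA j:{..<a1}. B j) (Ap \<Gamma> (int a1 * u + int a2 * int i))"
    unfolding bij_betw_def
  proof
    show "inj_on f (SIGMA j:{..<a1}. B j)"
    proof (rule inj_onI)
      fix p q
      assume pq: "p \<in> (SIGMA j:{..<a1}. B j)" "q \<in> (SIGMA j:{..<a1}. B j)" "f p = f q"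
      obtain j x j' x' where p: "p = (j, x)" and q: "q = (j', x')"
        by fastforce
      from pq have "int a1 * int x + int a2 * int j = int a1 * int x' + int a2 * int j'"
          "int j < int a1" "int j' < int a1"
        unfolding f_def p q by (auto simp flip: of_nat_mult of_nat_add)
      then have "j = j' \<and> x = x'"
        using int_coprime_decomposition_unique[of "int a1" "int a2"] cop
        by (metis coprime_int_iff of_nat_0_le_iff of_nat_eq_iff)
      then show "p = q"
        by (simp add: p q)
    qed
    show "f ` (SIGMA j:{..<a1}. B j) = Ap \<Gamma> (int a1 * u + int a2 * int i)"
    proof (intro equalityI subsetI)
      fix s assume "s \<in> f ` (SIGMA j:{..<a1}. B j)"
      then show "s \<in> Ap \<Gamma> (int a1 * u + int a2 * int i)"
        using mem_Ap unfolding f_def by auto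
    next
      fix s assume s: "s \<in> Ap \<Gamma> (int a1 * u + int a2 * int i)"
      then obtain x y where "s = a1 * x + a2 * y"
        unfolding Ap_def \<Gamma> by auto
      also have "\<dots> = a1 * x + a2 * (a1 * (y div a1) + y mod a1)"
        by simp
      also have "\<dots> = a1 * (x + a2 * (y div a1)) + a2 * (y mod a1)"
        by (simp only: algebra_simps)
      finally have "s = f (y mod a1, x + a2 * (y div a1))"
        unfolding f_def by simp
      moreover have "y mod a1 < a1"
        using i by simp
      ultimately show "s \<in> f ` (SIGMA j:{..<a1}. B j)"
        using mem_Ap s unfolding f_def by auto
    qed
  qed
  then have "card (Ap \<Gamma> (int a1 * u + int a2 * int i)) = card (SIGMA j:{..<a1}. B j)"
    by (simp add: bij_betw_same_card)
  also have "\<dots> = (\<Sum>j<a1. card (B j))"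
    using fin by (intro card_SigmaI) (auto simp: B_def)
  also have "\<dots> = (\<Sum>j\<in>{..<i} \<union> {i..<a1}. card (B j))"
    using i by (intro sum.cong) auto
  also have "\<dots> = (\<Sum>j<i. card (B j)) + (\<Sum>j=i..<a1. card (B j))"
    by (intro sum.union_disjoint) auto
  also have "\<dots> = i * card (Ap \<Gamma>1 (u + int a2)) + (a1 - i) * card (Ap \<Gamma>1 u)"
    by (simp add: B_def)
  finally show ?thesis
    by simp
qed

text \<open>In normal form the \<open>a2\<close> part is at most \<open>a1 * a2\<close>, so the rest
  is at least \<open>a1 * c\<close> and the first coordinate is at least \<open>c\<close>.\<close>

lemma cofinite_gluing_UNIV:
  fixes a1 a2 c :: nat
  assumes \<Gamma>: "\<Gamma> = {a1 * x + a2 * y | x y. x \<in> \<Gamma>1 \<and> y \<in> UNIV}"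
    and c: "\<forall>x\<ge>c. x \<in> \<Gamma>1" and cop: "coprime a1 a2" and a1: "a1 > 0"
  shows "\<forall>x \<ge> a1 * c + a1 * a2. x \<in> \<Gamma>"
proof (intro allI impI)
  fix x assume x: "a1 * c + a1 * a2 \<le> x"
  obtain u j where uj: "0 \<le> j" "j < int a1" "int x = int a1 * u + int a2 * j"
  proof (rule int_coprime_decomposition)
    show "coprime (int a1) (int a2)" "0 < int a1"
      using cop a1 by auto
  qed
  have "int a2 * j \<le> int a2 * int a1"
    using uj by (intro mult_left_mono) auto
  moreover have "int (a1 * c + a1 * a2) \<le> int x"
    using x by (simp only: of_nat_le_iff)
  ultimately have "int a1 * int c \<le> int a1 * u"
    using uj(3) by (simp add: mult.commute)
  then have u: "int c \<le> u"
    using a1 by simp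
  then have "int x = int (a1 * nat u + a2 * nat j)"
    using uj by simp
  then have "x = a1 * nat u + a2 * nat j"
    using of_nat_eq_iff by blast
  moreover have "nat u \<in> \<Gamma>1"
    using c u by (simp add: le_nat_iff)
  ultimately show "x \<in> \<Gamma>"
    unfolding \<Gamma> by blast
qed

lemma Ap_UNIV: "Ap UNIV z = {..<nat z}"
proof -
  have "int a - z \<in> range int \<longleftrightarrow> \<not> a < nat z" for a
  proof (rule iffI)
    assume "\<not> a < nat z"
    then have "int a - z = int (nat (int a - z))"
      by simp
    then show "int a - z \<in> range int"
      by (rule range_eqI)
  qed auto
  then show ?thesis
    unfolding Ap_def by auto
qed

section \<open>Bounds for Apery sets\<close>

text \<open>The last clause says \<open>card (Ap \<Gamma> z) \<ge> e * \<lceil>z / N\<rceil>\<close> for all integers \<open>z\<close>, without division.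
  Any atom \<open>N\<close> suffices, since all of them occur in every generating set.\<close>

lemma telescopic_Ap_bound:
  assumes "telescopic \<Gamma>"
  shows "\<exists>c e N. (\<forall>x\<ge>c. x \<in> \<Gamma>) \<and> e \<in> \<Gamma> \<and> e > 0 \<and> (\<forall>x\<in>\<Gamma>. x > 0 \<longrightarrow> e \<le> x) \<and> atom \<Gamma> N \<and>
    (\<forall>z t. int N * (t - 1) < z \<longrightarrow> int e * t \<le> int (card (Ap \<Gamma> z)))"
  using assms
proof induction
  case telescopic_UNIV
  have "atom UNIV 1"
    unfolding atom_def by auto
  then show ?case
    by (intro exI[of _ 0] exI[of _ 1]) (auto simp: Ap_UNIV)
next
  case (telescopic_gluing \<Gamma>1 \<Gamma> a1 a2)
  obtain c e N where c: "\<forall>x\<ge>c. x \<in> \<Gamma>1" and e: "e \<in> \<Gamma>1" "e > 0" "\<forall>x\<in>\<Gamma>1. x > 0 \<longrightarrow> e \<le> x"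
    and N: "atom \<Gamma>1 N"
    and IH: "\<And>z t. int N * (t - 1) < z \<Longrightarrow> int e * t \<le> int (card (Ap \<Gamma>1 z))"
    using telescopic_gluing.IH by blast
  have ns: "numerical_semigroup \<Gamma>1" "numerical_semigroup UNIV"
    and a2: "a2 \<in> \<Gamma>1" and cop: "coprime a1 a2"
    and nmin: "\<not> minimal_generator UNIV a1" "\<not> minimal_generator \<Gamma>1 a2"
    and \<Gamma>: "\<Gamma> = {a1 * x + a2 * y | x y. x \<in> \<Gamma>1 \<and> y \<in> UNIV}"
    using telescopic_gluing.hyps(2) unfolding is_gluing_def by auto
  note zero = numerical_semigroup_submonoid(1)[OF ns(1)]
  note add = numerical_semigroup_submonoid(2)[OF ns(1)]
  have one: "atom \<Delta> 1" if "1 \<in> \<Delta>" for \<Delta>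
    using that unfolding atom_def by auto
  \<comment> \<open>If present, 1 is always an atom and hence a minimal generator, which the gluing
    excludes. Next, \<open>a1 = 0\<close> would force \<open>a2 = 1\<close> by coprimality.\<close>
  have "a1 \<noteq> 1" "a2 \<noteq> 1"
    using nmin atom_imp_minimal_generator[OF ns(1)] atom_imp_minimal_generator[OF ns(2)] one a2
    by auto
  then have a1: "a1 \<ge> 2"
    using cop by (cases "a1 = 0") auto
  have a2N: "a1 * N < a2"
    using telescopic_gluing.hyps(3) atom_imp_minimal_generator[OF ns(1) N] by blast
  have fin: "finite (Ap \<Gamma>1 v)" for v
    using finite_Ap[OF c] .
  have e_le_N: "e \<le> N"
    using N e unfolding atom_def by auto
  have "\<forall>x \<ge> a1 * c + a1 * a2. x \<in> \<Gamma>"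
    using cofinite_gluing_UNIV[OF \<Gamma> c cop] a1 by simp
  moreover have "a1 * e \<in> \<Gamma>"
    unfolding \<Gamma> using e by (intro CollectI exI[of _ e] exI[of _ 0]) simp
  moreover have "a1 * e \<le> x" if x: "x \<in> \<Gamma>" "x > 0" for x
  proof -
    obtain p q where pq: "x = a1 * p + a2 * q" "p \<in> \<Gamma>1"
      using x unfolding \<Gamma> by auto
    show ?thesis
    proof (cases "p = 0")
      case True
      \<comment> \<open>A positive multiple of \<open>a2\<close> exceeds \<open>a1 * N\<close>,
        hence also \<open>a1 * e\<close>.\<close>
      then have "a2 \<le> x"
        using pq x by (cases q) auto
      moreover have "a1 * e \<le> a1 * N"
        using e_le_N by simp
      ultimately show ?thesis
        using a2N by linarith
    next
      case False
      then have "a1 * e \<le> a1 * p"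
        using e pq by simp
      then show ?thesis
        using pq(1) by linarith
    qed
  qed
  \<comment> \<open>The new atom for the bound is \<open>a2\<close>: a decomposition avoiding it in
    both summands would make \<open>a1 \<ge> 2\<close> divide \<open>a2\<close>.\<close>
  moreover have "atom \<Gamma> a2"
    unfolding atom_def
  proof (intro conjI ballI impI)
    show "a2 \<in> \<Gamma>"
      unfolding \<Gamma> using zero by (intro CollectI exI[of _ 0] exI[of _ 1]) simp
    show "a2 > 0"
      using a2N by simp
    fix x y assume x: "x \<in> \<Gamma>" and y: "y \<in> \<Gamma>" and eq: "a2 = x + y"
    obtain p q where xp: "x = a1 * p + a2 * q"
      using x unfolding \<Gamma> by blast
    obtain p' q' where yp: "y = a1 * p' + a2 * q'"
      using y unfolding \<Gamma> by blast
    note xy = xp yp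
    have "q \<noteq> 0 \<or> q' \<noteq> 0"
    proof (rule ccontr)
      assume "\<not> ?thesis"
      then have "a2 = a1 * (p + p')"
        using eq xy by (simp add: algebra_simps)
      then show False
        using cop a1 by simp
    qed
    then have "a2 \<le> x \<or> a2 \<le> y"
      using xy by (metis One_nat_def Suc_leI mult.right_neutral mult_le_mono2 neq0_conv trans_le_add2)
    then show "x = 0 \<or> y = 0"
      using eq by auto
  qed
  moreover have "int (a1 * e) * t \<le> int (card (Ap \<Gamma> z))" if z: "int a2 * (t - 1) < z" for z t
  proof (cases "t \<ge> 1")
    case False
    then have "int (a1 * e) * t \<le> 0"
      by (intro mult_nonneg_nonpos) auto
    then show ?thesis
      by linarith
  next
    case t: True
    obtain u j where "0 \<le> j" "j < int a1" "z = int a1 * u + int a2 * j"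
    proof (rule int_coprime_decomposition)
      show "coprime (int a1) (int a2)" "0 < int a1"
        using cop a1 by auto
    qed
    then obtain i where i: "i < a1" and zu: "z = int a1 * u + int a2 * int i"
      by (metis nonneg_int_cases of_nat_less_iff)
    \<comment> \<open>Removing \<open>a2 * i\<close> from \<open>z\<close> lowers \<open>t\<close>
      by \<open>i\<close>: the hypothesis becomes \<open>a2 * (w - 1) < a1 * u\<close>.\<close>
    define w where "w = t - int i"
    define P where "P = int (card (Ap \<Gamma>1 u))"
    define Q where "Q = int (card (Ap \<Gamma>1 (u + int a2)))"
    have card: "int (card (Ap \<Gamma> z)) = (int a1 - int i) * P + int i * Q"
      using card_Ap_gluing_UNIV[OF \<Gamma> add zero a2 cop fin i, of u] i
      by (simp add: zu P_def Q_def of_nat_diff)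
    have w: "int a2 * (w - 1) < int a1 * u"
      using z unfolding zu w_def by (simp add: algebra_simps)
    have a2N': "int a1 * int N \<le> int a2"
      using a2N by (simp flip: of_nat_mult)
    \<comment> \<open>Shifting \<open>u\<close> by \<open>a2\<close> raises \<open>w\<close> by
      \<open>a1\<close>. Since \<open>t \<ge> 1\<close> and \<open>i < a1\<close>, the factor
      \<open>w + a1 - 1\<close> is nonnegative, so \<open>a2\<close> may be replaced by the smaller
      \<open>a1 * N\<close>.\<close>
    have Q: "int e * (w + int a1) \<le> Q"
    proof -
      have "0 \<le> w + int a1 - 1"
        using t i unfolding w_def by simp
      then have "(int a1 * int N) * (w + int a1 - 1) \<le> int a2 * (w + int a1 - 1)"
        using a2N' by (intro mult_right_mono)
      also have "\<dots> < int a1 * (u + int a2)"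
        using w by (simp add: algebra_simps)
      finally have "int N * (w + int a1 - 1) < u + int a2"
        using a1 by (simp add: mult.assoc)
      then show ?thesis
        unfolding Q_def using IH by blast
    qed
    have goal: "int e * (int a1 * t) \<le> (int a1 - int i) * P + int i * Q"
    proof (cases "w \<ge> 1")
      case True
      then have "(int a1 * int N) * (w - 1) \<le> int a2 * (w - 1)"
        using a2N' by (intro mult_right_mono) auto
      also note w
      finally have "int N * (w - 1) < u"
        using a1 by (simp add: mult.assoc)
      then have "int e * w \<le> P"
        unfolding P_def using IH by blast
      then have "(int a1 - int i) * (int e * w) + int i * (int e * (w + int a1))
          \<le> (int a1 - int i) * P + int i * Q"
        using Q i by (intro add_mono mult_left_mono) auto
      \<comment> \<open>The weights fit:
        \<open>(a1 - i) * w + i * (w + a1) = a1 * (w + i) = a1 * t\<close>.\<close>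
      moreover have "(int a1 - int i) * (int e * w) + int i * (int e * (w + int a1))
          = int e * (int a1 * t)"
        unfolding w_def by (simp add: algebra_simps)
      ultimately show ?thesis
        by linarith
    next
      case False
      \<comment> \<open>For \<open>w \<le> 0\<close> the \<open>Q\<close> term alone suffices:
        \<open>a1 * t = a1 * w + a1 * i \<le> i * (w + a1)\<close>.\<close>
      have "int a1 * w \<le> int i * w"
        using False i by (intro mult_right_mono_neg) auto
      then have "int e * (int a1 * t) \<le> int e * (int i * (w + int a1))"
        unfolding w_def by (intro mult_left_mono) (auto simp: algebra_simps)
      also have "\<dots> = int i * (int e * (w + int a1))"
        by simp
      also have "\<dots> \<le> int i * Q"
        using Q by (intro mult_left_mono) auto
      also have "\<dots> \<le> (int a1 - int i) * P + int i * Q"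
        using i by (simp add: P_def)
      finally show ?thesis .
    qed
    then show ?thesis
      unfolding card by (simp add: mult.assoc mult.left_commute)
  qed
  ultimately show ?case
    using e a1
    by (intro exI[of _ "a1 * c + a1 * a2"] exI[of _ "a1 * e"] exI[of _ a2]) auto
qed

text \<open>Of two congruent elements modulo \<open>e\<close>, the larger minus \<open>e\<close> is
  the smaller plus a multiple of \<open>e\<close>, so it lies in \<open>\<Gamma>\<close>. Each
  residue class thus contributes at most one element.\<close>

lemma card_Ap_le:
  assumes add: "\<And>x y. x \<in> \<Gamma> \<Longrightarrow> y \<in> \<Gamma> \<Longrightarrow> x + y \<in> \<Gamma>" and zero: "0 \<in> \<Gamma>"
    and e: "e \<in> \<Gamma>" "e > 0"
  shows "card (Ap \<Gamma> (int e)) \<le> e"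
proof -
  have less: False
    if "a \<in> Ap \<Gamma> (int e)" "b \<in> Ap \<Gamma> (int e)" "a < b" "a mod e = b mod e" for a b
  proof -
    have "e dvd b - a"
      using that mod_eq_dvd_iff_nat[of a b e] by simp
    then obtain k where k: "b - a = e * k" ..
    with \<open>a < b\<close> obtain l where "k = Suc l"
      by (cases k) auto
    then have "b - a = l * e + e"
      using k by simp
    then have b: "b = a + l * e + e"
      using \<open>a < b\<close> by linarith
    have "a + l * e \<in> \<Gamma>"
      using that(1) add submonoid_mult[OF zero add e(1)] unfolding Ap_def by blast
    moreover have "int b - int e = int (a + l * e)"
      using b by simp
    ultimately show False
      using that(2) unfolding Ap_def by blast
  qed
  have "inj_on (\<lambda>a. a mod e) (Ap \<Gamma> (int e))"
    by (rule inj_onI) (metis less linorder_neqE_nat)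
  moreover have "(\<lambda>a. a mod e) ` Ap \<Gamma> (int e) \<subseteq> {..<e}"
    using e by auto
  ultimately have "card (Ap \<Gamma> (int e)) \<le> card {..<e}"
    using card_inj_on_le by blast
  then show ?thesis
    by simp
qed

section \<open>Divisor counts and the second Feng-Rao number\<close>

lemma int_diff_mem_iff: "int b - int c \<in> int ` \<Gamma> \<longleftrightarrow> c \<le> b \<and> b - c \<in> \<Gamma>"
proof
  assume "int b - int c \<in> int ` \<Gamma>"
  then obtain d where "d \<in> \<Gamma>" "int b - int c = int d"
    by auto
  then have "b = c + d" "d \<in> \<Gamma>"
    by auto
  then show "c \<le> b \<and> b - c \<in> \<Gamma>"
    by simp
next
  assume "c \<le> b \<and> b - c \<in> \<Gamma>"
  then show "int b - int c \<in> int ` \<Gamma>"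
    by (metis image_eqI of_nat_diff)
qed

lemma divisors_in_alt: "divisors_in \<Gamma> b = {c \<in> \<Gamma>. c \<le> b \<and> b - c \<in> \<Gamma>}"
  unfolding divisors_in_def int_diff_mem_iff by simp

text \<open>No two gaps add up to \<open>b\<close>, so among \<open>0, \<dots>, b\<close> exactly the gaps and their reflections
  are not divisors.\<close>

lemma card_divisors_in:
  assumes c: "\<forall>x\<ge>c. x \<in> \<Gamma>" and b: "2 * int c - 1 \<le> int b"
  shows "int (card (divisors_in \<Gamma> b)) = int b + 1 - 2 * int (genus \<Gamma>)"
proof -
  have gap: "x < c" if "x \<notin> \<Gamma>" for x
    using c that by (meson not_le)
  have gap_le: "x \<le> b" if "x \<notin> \<Gamma>" for x
    using gap[OF that] b by linarith
  have fin: "finite (- \<Gamma>)"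
    by (rule finite_subset[of _ "{..<c}"]) (use gap in auto)
  define R where "R = (\<lambda>x. b - x) ` (- \<Gamma>)"
  have "inj_on (\<lambda>x. b - x) (- \<Gamma>)"
  proof (rule inj_onI)
    fix x y assume "x \<in> - \<Gamma>" "y \<in> - \<Gamma>" "b - x = b - y"
    then show "x = y"
      using gap_le[of x] gap_le[of y] by simp
  qed
  then have cardR: "card R = genus \<Gamma>"
    unfolding R_def genus_def by (rule card_image)
  have disj: "- \<Gamma> \<inter> R = {}"
  proof -
    \<comment> \<open>Gaps are at most \<open>c - 1\<close>, so two of them sum to at most
      \<open>2 * c - 2 < b\<close>; this is where the threshold \<open>2 * c - 1\<close>
      enters.\<close>
    have False if x: "x \<notin> \<Gamma>" "y \<notin> \<Gamma>" "x = b - y" for x y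
      using gap[OF x(1)] gap[OF x(2)] gap_le[OF x(2)] x(3) b by linarith
    then show ?thesis
      unfolding R_def by blast
  qed
  have memR: "x \<in> R \<longleftrightarrow> x \<le> b \<and> b - x \<notin> \<Gamma>" for x
  proof
    assume "x \<in> R"
    then show "x \<le> b \<and> b - x \<notin> \<Gamma>"
      using gap_le unfolding R_def by auto
  next
    assume "x \<le> b \<and> b - x \<notin> \<Gamma>"
    then show "x \<in> R"
      unfolding R_def by (intro image_eqI[of _ _ "b - x"]) auto
  qed
  have sub: "- \<Gamma> \<union> R \<subseteq> {..b}"
    using gap_le memR by auto
  have "divisors_in \<Gamma> b = {..b} - (- \<Gamma> \<union> R)"
    unfolding divisors_in_alt using memR by auto
  then have "card (divisors_in \<Gamma> b) = card {..b} - card (- \<Gamma> \<union> R)"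
    using sub by (metis card_Diff_subset finite_atMost finite_subset)
  moreover have "card (- \<Gamma> \<union> R) = 2 * genus \<Gamma>"
    using fin disj cardR by (simp add: card_Un_disjoint R_def genus_def)
  moreover have "card (- \<Gamma> \<union> R) \<le> card {..b}"
    using sub by (intro card_mono) auto
  ultimately show ?thesis
    by simp
qed

text \<open>The reflection \<open>s \<mapsto> b2 - s\<close> maps the divisors of \<open>b2\<close> that do not divide \<open>b1\<close>
  onto \<open>Ap \<Gamma> (b2 - b1)\<close>.\<close>

lemma card_divisors_in_Un:
  assumes c: "\<forall>x\<ge>c. x \<in> \<Gamma>" and b: "2 * int c - 1 \<le> int b1" "b1 < b2"
  shows "int (card (divisors_in \<Gamma> b1 \<union> divisors_in \<Gamma> b2))
    = int b1 + 1 - 2 * int (genus \<Gamma>) + int (card (Ap \<Gamma> (int (b2 - b1))))"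
proof -
  have mem_Ap: "s \<in> Ap \<Gamma> (int (b2 - b1)) \<longleftrightarrow> s \<in> \<Gamma> \<and> \<not> (b2 - b1 \<le> s \<and> s - (b2 - b1) \<in> \<Gamma>)" for s
  proof -
    have "int s - int d \<in> int ` \<Gamma> \<longleftrightarrow> d \<le> s \<and> s - d \<in> \<Gamma>" for d
      by (rule int_diff_mem_iff)
    then show ?thesis
      unfolding Ap_def by simp
  qed
  have fin: "finite (divisors_in \<Gamma> b)" for b
    unfolding divisors_in_alt by (rule finite_subset[of _ "{..b}"]) auto
  have bij: "bij_betw (\<lambda>s. b2 - s) (divisors_in \<Gamma> b2 - divisors_in \<Gamma> b1) (Ap \<Gamma> (int (b2 - b1)))"
  proof (rule bij_betw_byWitness[where f' = "\<lambda>s. b2 - s"])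
    \<comment> \<open>An Apery element satisfies \<open>s < b2 - b1 + c\<close>, so
      \<open>b2 - s > b1 - c \<ge> c - 1\<close> over the integers; hence \<open>b2 - s\<close> lies
      beyond the gaps.\<close>
    have Ap_le: "s \<le> b2 \<and> c \<le> b2 - s" if "s \<in> Ap \<Gamma> (int (b2 - b1))" for s
    proof -
      have "\<not> (b2 - b1 \<le> s \<and> c \<le> s - (b2 - b1))"
        using that c mem_Ap by blast
      then show ?thesis
        using b by linarith
    qed
    show "\<forall>s\<in>divisors_in \<Gamma> b2 - divisors_in \<Gamma> b1. b2 - (b2 - s) = s"
      by (auto simp: divisors_in_alt)
    show "\<forall>s\<in>Ap \<Gamma> (int (b2 - b1)). b2 - (b2 - s) = s"
      using Ap_le by auto
    show "(\<lambda>s. b2 - s) ` (divisors_in \<Gamma> b2 - divisors_in \<Gamma> b1) \<subseteq> Ap \<Gamma> (int (b2 - b1))"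
    proof clarify
      fix s assume s: "s \<in> divisors_in \<Gamma> b2" "s \<notin> divisors_in \<Gamma> b1"
      have "b2 - s - (b2 - b1) = b1 - s" "b2 - b1 \<le> b2 - s \<longrightarrow> s \<le> b1"
        using s(1) b by (auto simp: divisors_in_alt)
      then show "b2 - s \<in> Ap \<Gamma> (int (b2 - b1))"
        using s unfolding mem_Ap divisors_in_alt by auto
    qed
    show "(\<lambda>s. b2 - s) ` Ap \<Gamma> (int (b2 - b1)) \<subseteq> divisors_in \<Gamma> b2 - divisors_in \<Gamma> b1"
    proof clarify
      fix s assume s: "s \<in> Ap \<Gamma> (int (b2 - b1))"
      have "b2 - s \<in> \<Gamma>" "s \<le> b2"
        using Ap_le[OF s] c by auto
      moreover have "b1 - (b2 - s) = s - (b2 - b1)" "b2 - s \<le> b1 \<longrightarrow> b2 - b1 \<le> s"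
        using \<open>s \<le> b2\<close> b by auto
      ultimately show "b2 - s \<in> divisors_in \<Gamma> b2 - divisors_in \<Gamma> b1"
        using s unfolding mem_Ap divisors_in_alt by auto
    qed
  qed
  have "divisors_in \<Gamma> b1 \<union> divisors_in \<Gamma> b2
      = divisors_in \<Gamma> b1 \<union> (divisors_in \<Gamma> b2 - divisors_in \<Gamma> b1)"
    by auto
  then have "card (divisors_in \<Gamma> b1 \<union> divisors_in \<Gamma> b2)
      = card (divisors_in \<Gamma> b1) + card (divisors_in \<Gamma> b2 - divisors_in \<Gamma> b1)"
    using fin by (metis Diff_disjoint card_Un_disjoint finite_Diff)
  then show ?thesis
    using bij_betw_same_card[OF bij] card_divisors_in[OF c b(1)] by simp
qed

text \<open>By \<open>card_divisors_in_Un\<close> the count depends only on \<open>b1\<close> and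
  the Apery set of \<open>b2 - b1\<close>. Both contributions are minimal at \<open>b1 = a\<close>,
  \<open>b2 = a + x0\<close>.\<close>

lemma E2_eqI:
  assumes c: "\<forall>x\<ge>c0. x \<in> \<Gamma>" and x0: "x0 > 0" "card (Ap \<Gamma> (int x0)) = v"
    and min: "\<And>x::nat. x > 0 \<Longrightarrow> v \<le> card (Ap \<Gamma> (int x))"
  shows "E2 \<Gamma> = int v"
proof -
  let ?c = "conductor \<Gamma>"
  have cond: "\<forall>x\<ge>?c. x \<in> \<Gamma>"
    unfolding conductor_def by (rule LeastI[of _ c0]) (rule c)
  have fr: "int (feng_rao2 \<Gamma> a) = int a + 1 - 2 * int (genus \<Gamma>) + int v"
    if a: "2 * int ?c - 1 \<le> int a" for a
  proof -
    let ?S = "{card (divisors_in \<Gamma> b1 \<union> divisors_in \<Gamma> b2) | b1 b2.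
            b1 \<in> \<Gamma> \<and> b2 \<in> \<Gamma> \<and> a \<le> b1 \<and> b1 < b2}"
    let ?d = "card (divisors_in \<Gamma> a \<union> divisors_in \<Gamma> (a + x0))"
    have "?c \<le> a"
      using a by linarith
    then have "a \<in> \<Gamma>" "a + x0 \<in> \<Gamma>"
      using cond by auto
    have d: "int ?d = int a + 1 - 2 * int (genus \<Gamma>) + int v"
      using card_divisors_in_Un[OF cond a, of "a + x0"] x0 by simp
    have "Inf ?S = ?d"
    proof (rule cInf_eq_minimum)
      show "?d \<in> ?S"
        using \<open>a \<in> \<Gamma>\<close> \<open>a + x0 \<in> \<Gamma>\<close> x0
        by (intro CollectI exI[of _ a] exI[of _ "a + x0"]) simp
      fix y assume "y \<in> ?S"
      then obtain b1 b2 where y: "y = card (divisors_in \<Gamma> b1 \<union> divisors_in \<Gamma> b2)"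
        and b: "a \<le> b1" "b1 < b2"
        by auto
      have "int y = int b1 + 1 - 2 * int (genus \<Gamma>) + int (card (Ap \<Gamma> (int (b2 - b1))))"
        unfolding y using card_divisors_in_Un[OF cond, of b1 b2] a b by simp
      then show "?d \<le> y"
        using d b min[of "b2 - b1"] by linarith
    qed
    then show ?thesis
      unfolding feng_rao2_def using d by simp
  qed
  show ?thesis
    unfolding E2_def
  proof (rule the_equality)
    show "\<forall>a. 2 * int ?c - 1 \<le> int a \<longrightarrow>
        int (feng_rao2 \<Gamma> a) = int a + 1 - 2 * int (genus \<Gamma>) + int v"
      using fr by blast
    fix f assume "\<forall>a. 2 * int ?c - 1 \<le> int a \<longrightarrow>
        int (feng_rao2 \<Gamma> a) = int a + 1 - 2 * int (genus \<Gamma>) + f"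
    \<comment> \<open>One admissible argument, \<open>2 * ?c\<close>, already determines the
      constant.\<close>
    then show "f = int v"
      using fr[of "2 * ?c"] by auto
  qed
qed

section \<open>The bound in terms of the given generators, and the value of
  \<open>E2\<close>\<close>

theorem corollary16:
  fixes \<Gamma> :: "nat set" and n :: "nat \<Rightarrow> nat" and m :: nat
  assumes "m \<ge> 1"
    and "\<forall>i\<in>{1..m}. n i > 0"
    and "Gcd (n ` {1..m}) = 1"
    and "strict_mono_on {1..m} n"
    and "\<Gamma> = gen_by (n ` {1..m})"
    and "telescopic \<Gamma>"
  shows "(\<forall>z::nat. int (card (Ap \<Gamma> (int z))) \<ge> int (n 1) * \<lceil>real z / real (n m)\<rceil>) \<and>
         E2 \<Gamma> = int (n 1)"
proof -
  obtain c e N where c: "\<forall>x\<ge>c. x \<in> \<Gamma>" and e: "e \<in> \<Gamma>" "e > 0" "\<forall>x\<in>\<Gamma>. x > 0 \<longrightarrow> e \<le> x"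
    and N: "atom \<Gamma> N"
    and bound: "\<And>z t. int N * (t - 1) < z \<Longrightarrow> int e * t \<le> int (card (Ap \<Gamma> z))"
    using telescopic_Ap_bound[OF assms(6)] by blast
  have mono: "n i \<le> n j" if "1 \<le> i" "i \<le> j" "j \<le> m" for i j
    using assms(4) that by (auto simp: strict_mono_on_leD)
  have "n 1 \<in> \<Gamma>"
    using assms(1) unfolding assms(5) by (intro generator_in_gen_by) auto
  then have "e \<le> n 1"
    using e assms(1,2) by auto
  moreover have "n 1 \<le> e"
  proof -
    \<comment> \<open>The positive element \<open>e\<close> contains some generator as a summand,
      and every generator is at least \<open>n 1\<close>.\<close>
    obtain a y where "a \<in> n ` {1..m}" "e = a + y"
      using gen_by_split[of "n ` {1..m}" e] e(1,2) unfolding assms(5) by blast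
    then show ?thesis
      using mono by (auto intro: trans_le_add1)
  qed
  ultimately have en: "e = n 1"
    by simp
  have "N \<in> n ` {1..m}"
    using N atom_gen_by_in_generators unfolding assms(5) by blast
  then have Nm: "N \<le> n m"
    using mono by auto
  have nm: "n m > 0"
    using assms(1,2) by auto
  have "int (n 1) * \<lceil>real z / real (n m)\<rceil> \<le> int (card (Ap \<Gamma> (int z)))" for z :: nat
  proof (cases "z = 0")
    case True
    then show ?thesis
      by simp
  next
    case False
    define t where "t = \<lceil>real z / real (n m)\<rceil>"
    have "t > 0"
      unfolding t_def using False nm by simp
    have "real_of_int (t - 1) < real z / real (n m)"
      unfolding t_def by linarith
    then have "real_of_int (int (n m) * (t - 1)) < real_of_int (int z)"
      using nm by (simp add: field_simps)
    then have "int (n m) * (t - 1) < int z"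
      by (simp only: of_int_less_iff)
    \<comment> \<open>As \<open>t - 1 \<ge> 0\<close>, enlarging \<open>N\<close> to
      \<open>n m\<close> only strengthens the hypothesis of \<open>bound\<close>.\<close>
    moreover have "int N * (t - 1) \<le> int (n m) * (t - 1)"
      using Nm \<open>t > 0\<close> by (intro mult_right_mono) auto
    ultimately show ?thesis
      using bound[of t "int z"] en unfolding t_def by simp
  qed
  moreover have "E2 \<Gamma> = int e"
  proof (rule E2_eqI[OF c e(2)])
    show min: "e \<le> card (Ap \<Gamma> (int x))" if "x > 0" for x :: nat
      \<comment> \<open>With \<open>t = 1\<close> the hypothesis of \<open>bound\<close> reduces to
        \<open>0 < x\<close>.\<close>
      using bound[of 1 "int x"] that by simp
    have "card (Ap \<Gamma> (int e)) \<le> e"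
    proof (rule card_Ap_le)
      show "x + y \<in> \<Gamma>" if "x \<in> \<Gamma>" "y \<in> \<Gamma>" for x y
        using that gen_by_add unfolding assms(5) by simp
      show "0 \<in> \<Gamma>"
        unfolding assms(5) by (rule gen_by_zero)
    qed (rule e)+
    then show "card (Ap \<Gamma> (int e)) = e"
      using min[OF e(2)] by simp
  qed
  ultimately show ?thesis
    using en by simp
qed

end
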